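(* Let $\alpha$ be a positive rational number, let $\mathcal O_\alpha=(O,\nu)$ be a canonical optimal factorization tree for $\alpha$, and let $n$ be a separation index for $\alpha$. If $\mathbf A$ is an optimal factorization of $\alpha_n$, then $\mathbf A\in\nu(V(O))$.
   Context: Write $\alpha=a/b$ with $a,b$ coprime positive integers. Let $p_1\ge\cdots\ge p_N$ be the primes dividing $ab$, listed with multiplicity. Put $\gamma(i)=1$ if $p_i\mid a$, $\gamma(i)=-1$ if $p_i\mid b$, and $\alpha_n=\prod_{i=1}^n p_i^{\gamma(i)}$ for $0\le n\le N$. An integer $n$ with $0\le n\le N$ is a separation index for $\alpha$ if for every prime $p$, at least one of $|\alpha_n|_p$ and $|\alpha/\alpha_n|_p$ equals $1$ (the $p$-adic absolute value). A factorization of a positive rational $\beta$ is a sequence $(a_1/b_1,a_2/b_2,\dots)$ with $a_i,b_i$ positive integers, $a_i=b_i=1$ for all but finitely many $i$, $\prod_i a_i/b_i=\beta$, $\max\{a_i,b_i\}\ge\max\{a_{i+1},b_{i+1}\}$ for all $i$, and $\gcd(a_i,b_j)=1$ for all $i,j$. For nonzero algebraic $\beta$, $m(\beta)$ is its logarithmic Mahler measure ($m(x/y)=\log\max\{x,y\}$ for a positive rational $x/y$ in lowest terms) and $m_t(\beta)=\inf\{(\sum_{n=1}^M m(\beta_n)^t)^{1/t}: M\in\mathbb N,\ \beta_n\in\overline{\mathbb Q}^\times,\ \beta=\prod\beta_n\}$ for $t>0$. A factorization $(a_i/b_i)$ of $\beta$ is optimal if there is $T_0>0$ with $m_t(\beta)=(\sum_i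 m(a_i/b_i)^t)^{1/t}$ for all $t\ge T_0$. Let $\mathfrak F_\alpha$ be the set of factorizations of $\alpha_n$, $0\le n\le N$. For $0\le n<N$, a factorization $(a_i/b_i)$ of $\alpha_n$ is a direct subfactorization of a factorization $(c_i/d_i)$ of $\alpha_{n+1}$ if either $p_{n+1}\mid a$ and for some $k$: $d_i=b_i$ for all $i$, $c_i=a_i$ for $i\ne k$, $c_k=a_kp_{n+1}$; or $p_{n+1}\mid b$ and for some $k$: $c_i=a_i$ for all $i$, $d_i=b_i$ for $i\ne k$, $d_k=b_kp_{n+1}$. A factorization tree for $\alpha$ is a pair $(T,\nu)$ with $T$ a rooted tree and $\nu:V(T)\to\mathfrak F_\alpha$, with parenting map $\phi$ and $\mathcal C(r)$ the set of children of $r$, such that: (1) root $r_0$ has $\nu(r_0)=(1,1,\dots)$; (2) if $n<N$ and $\nu(r)$ is a factorization of $\alpha_n$ then $r$ has a child; (3) $\nu(r)=\nu(s)$ and $\phi(r)=\phi(s)$ imply $r=s$; (4) for non-root $r$, $\nu(\phi(r))$ is a direct subfactorization of $\nu(r)$. For $0\le n<N$ and a factorization $\mathbf C=(a_1/b_1,\dots,a_\ell/b_\ell,1,1,\dots)$ of $\alpha_n$ with $a_\ell/b_\ell\ne1$ ($\ell=0$ if $\mathbf C=(1,1,\dots)$): if $p_{n+1}\mid a$, $\delta(\mathbf C)$ is the set of sequences obtained from $\mathbf C$ by replacing $a_k/b_k$ by $a_kp_{n+1}/b_k$ for some $k$ with $a_kp_{n+1}<b_k$, and $\epsilon(\mathbf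 C)=\{(a_1/b_1,\dots,a_\ell/b_\ell,p_{n+1}/1,1,\dots)\}$; if $p_{n+1}\mid b$, $\delta(\mathbf C)$ consists of sequences obtained by replacing $a_k/b_k$ by $a_k/(b_kp_{n+1})$ for some $k$ with $b_kp_{n+1}<a_k$, and $\epsilon(\mathbf C)=\{(a_1/b_1,\dots,a_\ell/b_\ell,1/p_{n+1},1,\dots)\}$. A canonical optimal factorization tree for $\alpha$ is a factorization tree such that for every non-leaf vertex $r$, $\nu(\mathcal C(r))=\delta(\nu(r))$ if $\delta(\nu(r))\ne\emptyset$ and $\nu(\mathcal C(r))=\epsilon(\nu(r))$ otherwise. *)

theory Defs
  imports Complex_Main "Berlekamp_Zassenhaus.Mahler_Measure"
begin

section \<open>Mahler measure of an algebraic number and metric Mahler measures\<close>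

text \<open>For algebraic \<open>\<beta>\<close> exactly one polynomial satisfies the description. An irreducible element
  of \<open>\<int>[X]\<close> with a complex root is nonconstant, hence automatically primitive.\<close>

definition min_poly_int :: "complex \<Rightarrow> int poly" where
  "min_poly_int \<beta> =
     (THE f. irreducible f \<and> lead_coeff f > 0 \<and> poly (map_poly of_int f) \<beta> = 0)"

definition log_mahler :: "complex \<Rightarrow> real" where
  "log_mahler \<beta> = ln (mahler_measure (min_poly_int \<beta>))"

definition metric_mahler :: "real \<Rightarrow> complex \<Rightarrow> real" where
  "metric_mahler t \<beta> =
     Inf {(\<Sum>k=1..M. log_mahler (\<beta>s k) powr t) powr (1 / t) | (M :: nat) \<beta>s.
            (\<forall>k\<in>{1..M}. algebraic (\<beta>s k) \<and> \<beta>s k \<noteq> 0) \<and> \<beta> = (\<Prod>k=1..M. \<beta>s k)}"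


section \<open>The partial products of a positive rational number\<close>

text \<open>Throughout, \<open>\<alpha>\<close> is meant to be positive, and \<open>\<alpha> = rat_num \<alpha> / rat_den \<alpha>\<close> in lowest terms.\<close>

definition rat_num :: "rat \<Rightarrow> nat" where
  "rat_num \<alpha> = nat (fst (quotient_of \<alpha>))"

definition rat_den :: "rat \<Rightarrow> nat" where
  "rat_den \<alpha> = nat (snd (quotient_of \<alpha>))"

definition prime_list :: "rat \<Rightarrow> nat list" where
  "prime_list \<alpha> =
     rev (sorted_list_of_multiset (prime_factorization (rat_num \<alpha> * rat_den \<alpha>)))"

abbreviation num_primes :: "rat \<Rightarrow> nat" where
  "num_primes \<alpha> \<equiv> length (prime_list \<alpha>)"

text \<open>\<open>prime_at \<alpha> i\<close> is \<open>p\<^sub>i\<close>, with indices \<open>1 \<le> i \<le> num_primes \<alpha>\<close>.\<close>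

definition prime_at :: "rat \<Rightarrow> nat \<Rightarrow> nat" where
  "prime_at \<alpha> i = prime_list \<alpha> ! (i - 1)"

definition prime_sign :: "rat \<Rightarrow> nat \<Rightarrow> int" where
  "prime_sign \<alpha> i = (if prime_at \<alpha> i dvd rat_num \<alpha> then 1 else - 1)"

definition partial_rat :: "rat \<Rightarrow> nat \<Rightarrow> rat" where
  "partial_rat \<alpha> n = (\<Prod>i=1..n. of_nat (prime_at \<alpha> i) powi prime_sign \<alpha> i)"

definition padic_abs :: "nat \<Rightarrow> rat \<Rightarrow> real" where
  "padic_abs p x =
     (if x = 0 then 0
      else real p powi (int (multiplicity (int p) (snd (quotient_of x)))
                        - int (multiplicity (int p) (fst (quotient_of x)))))"

definition separation_index :: "rat \<Rightarrow> nat \<Rightarrow> bool" where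
  "separation_index \<alpha> n \<longleftrightarrow>
     n \<le> num_primes \<alpha> \<and>
     (\<forall>p. prime p \<longrightarrow>
        padic_abs p (partial_rat \<alpha> n) = 1 \<or> padic_abs p (\<alpha> / partial_rat \<alpha> n) = 1)"


section \<open>Factorizations\<close>

text \<open>A sequence \<open>(a\<^sub>1/b\<^sub>1, a\<^sub>2/b\<^sub>2, \<dots>)\<close> is represented by the sequence of pairs \<open>(a\<^sub>i, b\<^sub>i)\<close>, indexed
  from \<open>0\<close>. In a factorization these fractions are in lowest terms, so that the pair and the
  rational number determine each other.\<close>

type_synonym frac_seq = "nat \<Rightarrow> nat \<times> nat"

definition frac_val :: "nat \<times> nat \<Rightarrow> 'a :: field_char_0" where
  "frac_val c = of_nat (fst c) / of_nat (snd c)"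

text \<open>The entries outside the support are \<open>1/1\<close>; they do not affect the product of all entries.\<close>

abbreviation frac_supp :: "frac_seq \<Rightarrow> nat set" where
  "frac_supp A \<equiv> {i. A i \<noteq> (1, 1)}"

definition factorization :: "rat \<Rightarrow> frac_seq \<Rightarrow> bool" where
  "factorization \<beta> A \<longleftrightarrow>
     (\<forall>i. fst (A i) > 0 \<and> snd (A i) > 0) \<and>
     finite (frac_supp A) \<and>
     (\<Prod>i\<in>frac_supp A. frac_val (A i)) = \<beta> \<and>
     (\<forall>i. max (fst (A i)) (snd (A i)) \<ge> max (fst (A (Suc i))) (snd (A (Suc i)))) \<and>
     (\<forall>i j. gcd (fst (A i)) (snd (A j)) = 1)"

text \<open>In the following series all but finitely many terms are \<open>log_mahler 1 powr t = 0\<close>.\<close>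

definition optimal_factorization :: "rat \<Rightarrow> frac_seq \<Rightarrow> bool" where
  "optimal_factorization \<beta> A \<longleftrightarrow>
     factorization \<beta> A \<and>
     (\<exists>T\<^sub>0>0. \<forall>t\<ge>T\<^sub>0.
        metric_mahler t (of_rat \<beta>) = (\<Sum>i. log_mahler (frac_val (A i)) powr t) powr (1 / t))"

definition factorization_set :: "rat \<Rightarrow> frac_seq set" where
  "factorization_set \<alpha> = {A. \<exists>n\<le>num_primes \<alpha>. factorization (partial_rat \<alpha> n) A}"

definition direct_subfactorization :: "rat \<Rightarrow> frac_seq \<Rightarrow> frac_seq \<Rightarrow> bool" where
  "direct_subfactorization \<alpha> A C \<longleftrightarrow>
     (\<exists>n<num_primes \<alpha>.
        factorization (partial_rat \<alpha> n) A \<and>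
        factorization (partial_rat \<alpha> (n + 1)) C \<and>
        (prime_at \<alpha> (n + 1) dvd rat_num \<alpha> \<and>
           (\<exists>k. (\<forall>i. snd (C i) = snd (A i)) \<and>
                (\<forall>i. i \<noteq> k \<longrightarrow> fst (C i) = fst (A i)) \<and>
                fst (C k) = fst (A k) * prime_at \<alpha> (n + 1))
         \<or> prime_at \<alpha> (n + 1) dvd rat_den \<alpha> \<and>
           (\<exists>k. (\<forall>i. fst (C i) = fst (A i)) \<and>
                (\<forall>i. i \<noteq> k \<longrightarrow> snd (C i) = snd (A i)) \<and>
                snd (C k) = snd (A k) * prime_at \<alpha> (n + 1))))"


section \<open>Factorization trees\<close>

text \<open>A rooted tree, possibly infinite, is given by its vertex set, its root and its parenting map.
  The value of the parenting map at the root is irrelevant.\<close>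

locale rooted_tree =
  fixes V :: "'v set" and r\<^sub>0 :: 'v and \<phi> :: "'v \<Rightarrow> 'v"
  assumes root_in: "r\<^sub>0 \<in> V"
    and parent_in: "\<And>r. r \<in> V \<Longrightarrow> r \<noteq> r\<^sub>0 \<Longrightarrow> \<phi> r \<in> V"
    and reaches_root: "\<And>r. r \<in> V \<Longrightarrow> \<exists>k. (\<phi> ^^ k) r = r\<^sub>0"
begin

definition children :: "'v \<Rightarrow> 'v set" where
  "children r = {s \<in> V. s \<noteq> r\<^sub>0 \<and> \<phi> s = r}"

end

locale factorization_tree = rooted_tree V r\<^sub>0 \<phi>
  for V :: "'v set" and r\<^sub>0 :: 'v and \<phi> :: "'v \<Rightarrow> 'v" +
  fixes \<alpha> :: rat and \<nu> :: "'v \<Rightarrow> frac_seq"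
  assumes label_in: "\<And>r. r \<in> V \<Longrightarrow> \<nu> r \<in> factorization_set \<alpha>"
    and label_root: "\<nu> r\<^sub>0 = (\<lambda>_. (1, 1))"
    and has_child: "\<And>r n. r \<in> V \<Longrightarrow> n < num_primes \<alpha> \<Longrightarrow>
          factorization (partial_rat \<alpha> n) (\<nu> r) \<Longrightarrow> children r \<noteq> {}"
    and siblings_distinct: "\<And>r s. r \<in> V \<Longrightarrow> s \<in> V \<Longrightarrow> r \<noteq> r\<^sub>0 \<Longrightarrow> s \<noteq> r\<^sub>0 \<Longrightarrow>
          \<nu> r = \<nu> s \<Longrightarrow> \<phi> r = \<phi> s \<Longrightarrow> r = s"
    and parent_label: "\<And>r. r \<in> V \<Longrightarrow> r \<noteq> r\<^sub>0 \<Longrightarrow> direct_subfactorization \<alpha> (\<nu> (\<phi> r)) (\<nu> r)"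

text \<open>\<open>delta \<alpha> n C\<close> and \<open>epsilon \<alpha> n C\<close> are meant for \<open>n < num_primes \<alpha>\<close> and a factorization \<open>C\<close> of
  \<open>partial_rat \<alpha> n\<close>. As \<open>C\<close> is indexed from \<open>0\<close>, its length \<open>\<ell>\<close> is also the position
  of the first entry after the last nontrivial one.\<close>

definition delta :: "rat \<Rightarrow> nat \<Rightarrow> frac_seq \<Rightarrow> frac_seq set" where
  "delta \<alpha> n C =
     (let p = prime_at \<alpha> (n + 1) in
      if p dvd rat_num \<alpha>
      then {C(k := (fst (C k) * p, snd (C k))) | k. fst (C k) * p < snd (C k)}
      else {C(k := (fst (C k), snd (C k) * p)) | k. snd (C k) * p < fst (C k)})"

definition frac_length :: "frac_seq \<Rightarrow> nat" where
  "frac_length C = (LEAST l. \<forall>i\<ge>l. C i = (1, 1))"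

definition epsilon :: "rat \<Rightarrow> nat \<Rightarrow> frac_seq \<Rightarrow> frac_seq set" where
  "epsilon \<alpha> n C =
     (let p = prime_at \<alpha> (n + 1) in
      if p dvd rat_num \<alpha>
      then {C(frac_length C := (p, 1))}
      else {C(frac_length C := (1, p))})"

text \<open>The numbers \<open>partial_rat \<alpha> n\<close>, \<open>n \<le> num_primes \<alpha>\<close>, are distinct, and by \<open>parent_label\<close> the label
  of a non-leaf is a factorization of one of them with \<open>n < num_primes \<alpha>\<close>. So exactly
  one \<open>n\<close> is relevant for each non-leaf \<open>r\<close> below.\<close>

locale canonical_optimal_factorization_tree = factorization_tree V r\<^sub>0 \<phi> \<alpha> \<nu>
  for V :: "'v set" and r\<^sub>0 :: 'v and \<phi> :: "'v \<Rightarrow> 'v" and \<alpha> :: rat and \<nu> :: "'v \<Rightarrow> frac_seq" +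
  assumes labels_children: "\<And>r n. r \<in> V \<Longrightarrow> children r \<noteq> {} \<Longrightarrow> n < num_primes \<alpha> \<Longrightarrow>
          factorization (partial_rat \<alpha> n) (\<nu> r) \<Longrightarrow>
          \<nu> ` children r =
            (if delta \<alpha> n (\<nu> r) \<noteq> {} then delta \<alpha> n (\<nu> r) else epsilon \<alpha> n (\<nu> r))"

end

theory Submission
  imports Defs
begin

text \<open>For large \<open>t\<close> an optimal factorization beats every other rational product, so replacing some
  entries by others must not trade one maximum for strictly smaller ones. Hence all nontrivial maxima
  of an optimal \<open>A\<close> are prime. Rebuild \<open>A\<close> by inserting its primes in decreasing order, copies of
  the same prime going to existing entries before they open new ones. A copy of \<open>p\<close> that joins an
  existing entry is a move of \<open>delta\<close>. If a copy of \<open>p\<close> has to open a new entry while \<open>delta\<close> still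
  allows it to join an entry \<open>l\<close>, moving it there in \<open>A\<close> and splitting off the smaller primes that
  shared its side of \<open>l\<close> replaces the maximum \<open>p\<close> by smaller ones, a contradiction. So \<open>A\<close> is reached
  within the canonical tree.\<close>

section \<open>The Mahler measure of a rational number\<close>

text \<open>Otherwise \<open>coprime\<close> denotes that constant.\<close>

hide_const (open) Unique_Factorization.coprime


text \<open>One of two factors has degree 0; this constant divides both coprime coefficients, so it
  is a unit. Since \<open>int poly\<close> is factorial, irreducibility gives primality.\<close>

lemma prime_elem_linear_int_poly:
  fixes x y :: int
  assumes "y \<noteq> 0" and "coprime x y"
  shows "prime_elem [:- x, y:]"
proof -
  have "irreducible [:- x, y:]"
  proof (rule irreducibleI)
    fix g h :: "int poly"
    assume eq: "[:- x, y:] = g * h"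
    have const: "is_unit g" if deg: "degree g = 0" and gh: "g * h = [:- x, y:]" for g h :: "int poly"
    proof -
      obtain c where c: "g = [:c:]"
        using deg by (elim degree_eq_zeroE)
      have "smult c h = [:- x, y:]"
        using gh c by simp
      then have "c * coeff h 0 = - x" "c * coeff h 1 = y"
        by (metis coeff_pCons_0 coeff_smult, metis One_nat_def coeff_pCons_0 coeff_pCons_Suc coeff_smult)
      then have "c dvd x" "c dvd y"
        by (metis dvd_minus_iff dvd_triv_left)+
      then have "is_unit c"
        using assms(2) coprime_common_divisor by blast
      then show ?thesis
        by (simp add: c is_unit_const_poly_iff)
    qed
    have nz: "g \<noteq> 0" "h \<noteq> 0"
      using eq assms(1) by force+
    have "degree g + degree h = 1"
      using degree_mult_eq[OF nz] assms(1) by (simp flip: eq)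
    then show "is_unit g \<or> is_unit h"
      using const[of g h] const[of h g] eq by (auto simp: mult.commute add_is_1)
  qed (use assms in \<open>auto simp: is_unit_poly_iff\<close>)
  then show ?thesis
    by (rule irreducible_imp_prime_elem)
qed

text \<open>Pseudo-division by the linear polynomial leaves a constant remainder that vanishes at
  the root. So the linear polynomial divides a nonzero constant times \<open>g\<close>; being prime
  and of degree 1, it divides \<open>g\<close>.\<close>

lemma linear_int_poly_dvd:
  fixes x y :: int and g :: "int poly"
  assumes "y \<noteq> 0" and "coprime x y"
    and root: "poly (map_poly of_int g) (of_int x / of_int y :: complex) = 0"
  shows "[:- x, y:] dvd g"
proof -
  define f where "f = [:- x, y:]"
  have f0: "f \<noteq> 0" and degf: "degree f = 1"
    using assms(1) by (auto simp: f_def)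
  define r where "r = pseudo_mod g f"
  obtain a q where a: "a \<noteq> 0" "smult a g = f * q + r"
    using pseudo_mod(1)[OF f0, of g] by (auto simp: r_def)
  have "degree r = 0"
    using pseudo_mod(2)[OF f0, of g] degf by (auto simp: r_def)
  then obtain c where c: "r = [:c:]"
    by (elim degree_eq_zeroE)
  let ?e = "\<lambda>h :: int poly. poly (map_poly of_int h) (of_int x / of_int y :: complex)"
  have ef: "?e f = 0"
    using assms(1) by (simp add: f_def)
  have "?e (smult a g) = ?e f * ?e q + ?e r"
    unfolding a(2) by (simp add: of_int_poly_hom.hom_add of_int_poly_hom.hom_mult)
  moreover have "?e (smult a g) = of_int a * ?e g"
    by (simp add: hom_distribs)
  ultimately have "?e r = 0"
    using root ef by simp
  then have "r = 0"
    by (cases "c = 0") (simp_all add: c)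
  then have "f dvd [:a:] * g"
    using a(2) by simp
  moreover have "\<not> f dvd [:a:]"
    using a(1) degf by (metis One_nat_def degree_pCons_0 dvd_imp_degree_le not_one_le_zero pCons_eq_0_iff)
  ultimately show ?thesis
    using prime_elem_dvd_multD[OF prime_elem_linear_int_poly[OF assms(1,2)], of "[:a:]" g]
    unfolding f_def by iprover
qed

text \<open>Any candidate is a multiple of the linear polynomial. Irreducibility makes the cofactor
  a unit, and the signs of the leading coefficients make it 1.\<close>

lemma min_poly_int_rational:
  fixes x y :: int
  assumes "y > 0" and "coprime x y"
  shows "min_poly_int (of_int x / of_int y) = [:- x, y:]"
  unfolding min_poly_int_def
proof (rule the_equality)
  show "irreducible [:- x, y:] \<and> lead_coeff [:- x, y:] > 0 \<and>
      poly (map_poly of_int [:- x, y:]) (of_int x / of_int y :: complex) = 0"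
    using prime_elem_imp_irreducible[OF prime_elem_linear_int_poly[of y x]] assms by auto
next
  fix g :: "int poly"
  assume g: "irreducible g \<and> lead_coeff g > 0 \<and>
      poly (map_poly of_int g) (of_int x / of_int y :: complex) = 0"
  have "[:- x, y:] dvd g"
    using linear_int_poly_dvd[of y x g] assms g by auto
  then obtain h where h: "g = [:- x, y:] * h"
    by (elim dvdE)
  have "\<not> is_unit [:- x, y:]"
    using prime_elem_linear_int_poly[of y x] assms unfolding prime_elem_def by blast
  then have "is_unit h"
    using g h irreducibleD by blast
  then obtain c where c: "h = [:c:]" "is_unit c"
    by (auto simp: is_unit_poly_iff)
  have "lead_coeff g = y * c"
    unfolding h lead_coeff_mult using assms(1) c by simp
  then have "c > 0"
    using g assms(1) by (simp add: zero_less_mult_iff)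
  then have "c = 1"
    using c(2) by auto
  then show "g = [:- x, y:]"
    using h c(1) by (simp add: one_pCons[symmetric])
qed

lemma mahler_measure_linear:
  fixes x y :: int
  assumes "y > 0"
  shows "mahler_measure [:- x, y:] = max \<bar>real_of_int x\<bar> (real_of_int y)"
proof -
  define p where "p = map_poly complex_of_int [:- x, y:]"
  have p: "p = [:- of_int x, of_int y:]"
    using assms by (simp add: p_def)
  then have "length (complex_roots_complex p) = 1"
    using complex_roots(2)[of p] assms by simp
  then obtain r where r: "complex_roots_complex p = [r]"
    by (metis One_nat_def length_0_conv length_Suc_conv)
  have "smult (of_int y) [:- r, 1:] = [:- complex_of_int x, of_int y:]"
    using complex_roots(1)[of p] assms unfolding r by (simp add: p)
  then have "r = of_int x / of_int y"
    using assms by (simp add: field_simps)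
  then have "mahler_measure [:- x, y:] = of_int y * max 1 (\<bar>of_int x\<bar> / of_int y)"
    unfolding mahler_measure_def mahler_measure_poly_def p_def[symmetric] r
    using assms by (simp add: p norm_divide)
  then show ?thesis
    using assms by (simp add: max_def field_simps)
qed

lemma log_mahler_frac:
  assumes "fst c > 0" "snd c > 0" and "coprime (fst c) (snd c)"
  shows "log_mahler (frac_val c) = ln (real (max (fst c) (snd c)))"
proof -
  have "frac_val c = (of_int (int (fst c)) / of_int (int (snd c)) :: complex)"
    by (simp only: frac_val_def of_int_of_nat_eq)
  moreover have "min_poly_int (of_int (int (fst c)) / of_int (int (snd c))) = [:- int (fst c), int (snd c):]"
    using assms by (intro min_poly_int_rational) (simp_all only: of_nat_0_less_iff coprime_int_iff)
  moreover have "mahler_measure [:- int (fst c), int (snd c):] = max \<bar>real_of_int (int (fst c))\<bar> (real_of_int (int (snd c)))"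
    using assms by (intro mahler_measure_linear) (simp only: of_nat_0_less_iff)
  ultimately show ?thesis
    unfolding log_mahler_def by (simp only: of_int_of_nat_eq abs_of_nat of_nat_max)
qed

section \<open>Exchange arguments for optimal factorizations\<close>

definition frac_max :: "nat \<times> nat \<Rightarrow> nat" where
  "frac_max c = max (fst c) (snd c)"

text \<open>The outer exponent \<open>1 / t\<close> of the metric Mahler measure is left out, so
  that costs add up and common entries cancel. Trivial entries cost 0 for every \<open>t\<close>, as
  \<open>0 powr t = 0\<close>.\<close>

definition frac_cost :: "real \<Rightarrow> nat \<times> nat \<Rightarrow> real" where
  "frac_cost t c = ln (real (frac_max c)) powr t"

definition reduced_frac :: "nat \<times> nat \<Rightarrow> bool" where
  "reduced_frac c \<longleftrightarrow> fst c > 0 \<and> snd c > 0 \<and> gcd (fst c) (snd c) = 1"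

text \<open>The competitors \<open>xs\<close> need not keep the coprimality of distinct entries. The condition is invariant
  under passing to reciprocals, which spares a second treatment of the primes of the denominator.\<close>

definition locally_minimal :: "frac_seq \<Rightarrow> bool" where
  "locally_minimal A \<longleftrightarrow>
     (\<forall>K xs. finite K \<longrightarrow> (\<forall>x\<in>set xs. reduced_frac x) \<longrightarrow>
        (\<Prod>i\<in>K. frac_val (A i) :: rat) = prod_list (map frac_val xs) \<longrightarrow>
        (\<forall>\<^sub>F t in at_top. (\<Sum>i\<in>K. frac_cost t (A i)) \<le> (\<Sum>x\<leftarrow>xs. frac_cost t x)))"

section \<open>From optimality to local minimality\<close>

lemma log_mahler_reduced:
  "reduced_frac c \<Longrightarrow> log_mahler (frac_val c) powr t = frac_cost t c"
  using log_mahler_frac[of c] coprime_iff_gcd_eq_1[of "fst c" "snd c"]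
  unfolding reduced_frac_def frac_cost_def frac_max_def by simp

lemma frac_cost_nonneg: "frac_cost t c \<ge> 0"
  by (simp add: frac_cost_def)

lemma frac_cost_trivial [simp]: "frac_cost t (Suc 0, Suc 0) = 0"
  by (simp add: frac_cost_def frac_max_def)

lemma frac_val_trivial [simp]: "frac_val (Suc 0, Suc 0) = 1"
  by (simp add: frac_val_def)

lemma frac_val_swap: "frac_val (prod.swap c) = inverse (frac_val c)"
  by (simp add: frac_val_def)

lemma of_rat_frac_val: "of_rat (frac_val c) = frac_val c"
  by (simp add: frac_val_def of_rat_divide)

lemma factorization_reduced: "factorization \<beta> A \<Longrightarrow> reduced_frac (A i)"
  unfolding factorization_def reduced_frac_def by blast

lemma frac_val_nonzero: "reduced_frac c \<Longrightarrow> frac_val c \<noteq> 0"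
  by (simp add: frac_val_def reduced_frac_def)

lemma algebraic_frac_val: "algebraic (frac_val c)"
proof -
  have "frac_val c \<in> \<rat>"
    unfolding frac_val_def by (intro Rats_divide Rats_of_nat)
  then show ?thesis
    by (rule rat_imp_algebraic)
qed

text \<open>The entries of \<open>xs\<close> form one of the products over which the infimum is
  taken, and 0 is a lower bound.\<close>

lemma metric_mahler_le:
  assumes "\<forall>x\<in>set xs. reduced_frac x"
  shows "metric_mahler t (prod_list (map frac_val xs)) \<le> (\<Sum>x\<leftarrow>xs. frac_cost t x) powr (1 / t)"
proof -
  define \<beta>s :: "nat \<Rightarrow> complex" where "\<beta>s k = frac_val (xs ! (k - 1))" for k
  have red: "reduced_frac (xs ! (k - 1))" if "k \<in> {1..length xs}" for k
    using that assms by (auto intro!: nth_mem)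
  have "\<forall>k\<in>{1..length xs}. algebraic (\<beta>s k) \<and> \<beta>s k \<noteq> 0"
    using red by (simp add: \<beta>s_def algebraic_frac_val frac_val_nonzero del: One_nat_def)
  moreover have "prod_list (map frac_val xs) = (\<Prod>k=1..length xs. \<beta>s k)"
    by (simp add: prod.list_conv_set_nth \<beta>s_def prod.atLeast1_atMost_eq atLeast0LessThan)
  moreover have "(\<Sum>x\<leftarrow>xs. frac_cost t x) = (\<Sum>k=1..length xs. log_mahler (\<beta>s k) powr t)"
  proof -
    have "(\<Sum>x\<leftarrow>xs. frac_cost t x) = (\<Sum>k=1..length xs. frac_cost t (xs ! (k - 1)))"
      by (simp add: sum.list_conv_set_nth sum.atLeast1_atMost_eq atLeast0LessThan)
    also have "\<dots> = (\<Sum>k=1..length xs. log_mahler (\<beta>s k) powr t)"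
      using log_mahler_reduced[OF red] by (intro sum.cong) (auto simp: \<beta>s_def)
    finally show ?thesis .
  qed
  ultimately show ?thesis
    unfolding metric_mahler_def
    by (intro cInf_lower bdd_belowI[of _ 0]) (auto intro!: exI[of _ "length xs"] exI[of _ \<beta>s])
qed

lemma optimal_imp_locally_minimal:
  assumes "optimal_factorization \<beta> A"
  shows "locally_minimal A"
  unfolding locally_minimal_def
proof (intro allI impI)
  fix K :: "nat set" and xs :: "(nat \<times> nat) list"
  assume K: "finite K" and xs: "\<forall>x\<in>set xs. reduced_frac x"
    and eq: "(\<Prod>i\<in>K. frac_val (A i) :: rat) = prod_list (map frac_val xs)"
  obtain T where T: "T > 0" and opt: "\<And>t. t \<ge> T \<Longrightarrow>
      metric_mahler t (of_rat \<beta>) = (\<Sum>i. log_mahler (frac_val (A i)) powr t) powr (1 / t)"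
    using assms unfolding optimal_factorization_def by blast
  have fact: "factorization \<beta> A"
    using assms unfolding optimal_factorization_def by blast
  note red = factorization_reduced[OF fact]
  have fin: "finite (frac_supp A)"
    using fact by (simp add: factorization_def)
  define S where "S = frac_supp A \<union> K"
  have finS: "finite S" and KS: "K \<subseteq> S"
    using fin K by (auto simp: S_def)
  obtain js where js: "set js = S - K" "distinct js"
    using finite_distinct_list[of "S - K"] finS by blast
  \<comment> \<open>The competitor for all of \<beta>: entries in \<open>K\<close> are replaced by
    \<open>xs\<close>, the others are kept.\<close>
  define ys where "ys = xs @ map A js"
  have "\<beta> = (\<Prod>i\<in>S. frac_val (A i))"
    unfolding S_def using fact fin K
    by (subst prod.mono_neutral_left[symmetric, of _ "frac_supp A"])
       (auto simp: factorization_def)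
  also have "\<dots> = (\<Prod>i\<in>K. frac_val (A i)) * (\<Prod>i\<in>S - K. frac_val (A i))"
    using prod.subset_diff[OF KS finS] by (simp add: mult.commute)
  also have "\<dots> = prod_list (map frac_val ys)"
    using js by (simp add: ys_def eq prod.distinct_set_conv_list[symmetric] o_def)
  finally have "\<beta> = prod_list (map frac_val ys)" .
  moreover have "of_rat (prod_list (map frac_val ys)) = (prod_list (map frac_val ys) :: complex)"
    by (induction ys) (simp_all add: of_rat_mult of_rat_frac_val)
  ultimately have \<beta>: "of_rat \<beta> = (prod_list (map frac_val ys) :: complex)"
    by simp
  have "(\<Sum>i\<in>K. frac_cost t (A i)) \<le> (\<Sum>x\<leftarrow>xs. frac_cost t x)" if "t \<ge> T" for t
  proof -
    have "(\<Sum>i. log_mahler (frac_val (A i)) powr t) = (\<Sum>i. frac_cost t (A i))"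
      by (simp add: log_mahler_reduced[OF red])
    also have "\<dots> = (\<Sum>i\<in>S. frac_cost t (A i))"
      by (intro suminf_finite finS) (auto simp: S_def)
    finally have "(\<Sum>i\<in>S. frac_cost t (A i)) powr (1 / t) \<le> (\<Sum>x\<leftarrow>ys. frac_cost t x) powr (1 / t)"
      using metric_mahler_le[of ys t] opt[OF that] xs red by (auto simp: \<beta> ys_def)
    moreover have "(\<Sum>x\<leftarrow>ys. frac_cost t x) \<ge> 0"
      by (intro sum_list_nonneg) (auto simp: frac_cost_nonneg)
    \<comment> \<open>The exponent \<open>1 / t\<close> is positive, so it can be removed by strict
      monotonicity; afterwards the entries outside \<open>K\<close> cancel.\<close>
    ultimately have "(\<Sum>i\<in>S. frac_cost t (A i)) \<le> (\<Sum>x\<leftarrow>ys. frac_cost t x)"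
      using that T powr_less_mono2[of "1 / t" "\<Sum>x\<leftarrow>ys. frac_cost t x" "\<Sum>i\<in>S. frac_cost t (A i)"]
      by force
    moreover have "(\<Sum>x\<leftarrow>ys. frac_cost t x) = (\<Sum>x\<leftarrow>xs. frac_cost t x) + (\<Sum>i\<in>S - K. frac_cost t (A i))"
      using js by (simp add: ys_def sum.distinct_set_conv_list[symmetric] o_def)
    ultimately show ?thesis
      using sum.subset_diff[OF KS finS, of "\<lambda>i. frac_cost t (A i)"] by simp
  qed
  then show "\<forall>\<^sub>F t in at_top. (\<Sum>i\<in>K. frac_cost t (A i)) \<le> (\<Sum>x\<leftarrow>xs. frac_cost t x)"
    unfolding eventually_at_top_linorder by blast
qed

text \<open>Replacing the competitors by their reciprocals inverts both products and leaves every
  cost unchanged.\<close>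

lemma locally_minimal_swap:
  assumes "locally_minimal A"
  shows "locally_minimal (prod.swap \<circ> A)"
  unfolding locally_minimal_def
proof (intro allI impI)
  fix K :: "nat set" and xs :: "(nat \<times> nat) list"
  assume "finite K" and xs: "\<forall>x\<in>set xs. reduced_frac x"
    and eq: "(\<Prod>i\<in>K. frac_val ((prod.swap \<circ> A) i) :: rat) = prod_list (map frac_val xs)"
  have [simp]: "frac_cost t (prod.swap c) = frac_cost t c" for t c
    by (simp add: frac_cost_def frac_max_def max.commute)
  have inv: "prod_list (map frac_val (map prod.swap xs)) = inverse (prod_list (map frac_val xs) :: rat)"
    by (induction xs) (simp_all add: frac_val_swap)
  have "inverse (\<Prod>i\<in>K. frac_val (A i) :: rat) = prod_list (map frac_val xs)"
    unfolding eq[symmetric] by (simp add: frac_val_swap prod_inversef[symmetric] o_def)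
  then have "(\<Prod>i\<in>K. frac_val (A i) :: rat) = prod_list (map frac_val (map prod.swap xs))"
    unfolding inv by (metis inverse_inverse_eq)
  then have "\<forall>\<^sub>F t in at_top. (\<Sum>i\<in>K. frac_cost t (A i)) \<le> (\<Sum>x\<leftarrow>map prod.swap xs. frac_cost t x)"
    using assms \<open>finite K\<close> xs unfolding locally_minimal_def
    by (elim allE[of _ K] allE[of _ "map prod.swap xs"]) (auto simp: reduced_frac_def gcd.commute)
  then show "\<forall>\<^sub>F t in at_top. (\<Sum>i\<in>K. frac_cost t ((prod.swap \<circ> A) i)) \<le> (\<Sum>x\<leftarrow>xs. frac_cost t x)"
    by (simp add: o_def)
qed

section \<open>Comparison of costs for large exponents\<close>

lemma tendsto_powr_lt_1:
  fixes x :: real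
  assumes "0 \<le> x" and "x < 1"
  shows "((\<lambda>t. x powr t) \<longlongrightarrow> 0) at_top"
proof (cases "x = 0")
  case False
  have "filterlim (\<lambda>t. ln x * t) at_bot at_top"
    using assms False by (intro filterlim_tendsto_neg_mult_at_bot[OF tendsto_const] filterlim_ident) auto
  then have "((\<lambda>t. exp (ln x * t)) \<longlongrightarrow> 0) at_top"
    by (rule filterlim_compose[OF exp_at_bot])
  then show ?thesis
    using False by (simp add: powr_def mult.commute)
qed simp

text \<open>After division by \<open>ln m powr t\<close> each of the finitely many terms is the
  power with exponent \<open>t\<close> of a fixed number in [0, 1), so the sum tends to 0 however
  long \<open>xs\<close> is.\<close>

lemma eventually_sum_frac_cost_less:
  assumes "\<And>x. x \<in> set xs \<Longrightarrow> reduced_frac x \<and> frac_max x < m" and m: "m > 1"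
  shows "\<forall>\<^sub>F t in at_top. (\<Sum>x\<leftarrow>xs. frac_cost t x) < ln (real m) powr t"
proof -
  have lim: "((\<lambda>t. frac_cost t x / ln (real m) powr t) \<longlongrightarrow> 0) at_top" if "x \<in> set xs" for x
  proof -
    define u where "u = ln (real (frac_max x))"
    have "u \<ge> 0" "u < ln m"
      using assms(1)[OF that] by (auto simp: u_def frac_max_def reduced_frac_def)
    then have "((\<lambda>t. (u / ln m) powr t) \<longlongrightarrow> 0) at_top"
      using m by (intro tendsto_powr_lt_1) (auto simp: field_simps)
    then show ?thesis
      using \<open>u \<ge> 0\<close> m by (simp add: frac_cost_def u_def[symmetric] powr_divide)
  qed
  have "((\<lambda>t. \<Sum>x\<leftarrow>xs. frac_cost t x / ln (real m) powr t) \<longlongrightarrow> (\<Sum>x\<leftarrow>xs. 0)) at_top"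
    using lim by (induction xs) (auto intro!: tendsto_add_zero simp del: frac_cost_trivial)
  then have "((\<lambda>t. \<Sum>x\<leftarrow>xs. frac_cost t x / ln (real m) powr t) \<longlongrightarrow> 0) at_top"
    by simp
  then have "\<forall>\<^sub>F t in at_top. (\<Sum>x\<leftarrow>xs. frac_cost t x / ln (real m) powr t) < 1"
    by (rule order_tendstoD) simp
  then show ?thesis
  proof eventually_elim
    case (elim t)
    have "(\<Sum>x\<leftarrow>xs. frac_cost t x / ln (real m) powr t) = (\<Sum>x\<leftarrow>xs. frac_cost t x) / ln (real m) powr t"
      by (induction xs) (simp_all add: add_divide_distrib)
    then show ?case
      using elim m by (simp add: pos_divide_less_eq)
  qed
qed

text \<open>The common form of all exchanges: \<open>xs\<close> is paid for by the entries of
  \<open>K\<close> other than \<open>j\<close>, and for large \<open>t\<close> all of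
  \<open>ys\<close> together costs less than entry \<open>j\<close> alone.\<close>

lemma locally_minimal_no_exchange:
  assumes "locally_minimal A" and "finite K" and "j \<in> K"
    and red: "\<And>x. x \<in> set xs \<union> set ys \<Longrightarrow> reduced_frac x"
    and "\<And>t. t > 0 \<Longrightarrow> (\<Sum>x\<leftarrow>xs. frac_cost t x) \<le> (\<Sum>i\<in>K - {j}. frac_cost t (A i))"
    and small: "\<And>y. y \<in> set ys \<Longrightarrow> frac_max y < frac_max (A j)"
    and "frac_max (A j) > 1"
  shows "(\<Prod>i\<in>K. frac_val (A i) :: rat) \<noteq> prod_list (map frac_val (xs @ ys))"
proof
  assume "(\<Prod>i\<in>K. frac_val (A i) :: rat) = prod_list (map frac_val (xs @ ys))"
  then have "\<forall>\<^sub>F t in at_top. (\<Sum>i\<in>K. frac_cost t (A i)) \<le> (\<Sum>x\<leftarrow>xs @ ys. frac_cost t x)"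
    using assms(1,2) red unfolding locally_minimal_def
    by (elim allE[of _ K] allE[of _ "xs @ ys"]) auto
  moreover have "\<forall>\<^sub>F t in at_top. (\<Sum>y\<leftarrow>ys. frac_cost t y) < frac_cost t (A j)"
    unfolding frac_cost_def[of _ "A j"] using assms by (intro eventually_sum_frac_cost_less) auto
  \<comment> \<open>The bound on \<open>xs\<close> is available for t > 0 only, so the contradiction
    first takes the form that t is eventually at most 0.\<close>
  ultimately have "\<forall>\<^sub>F t in at_top. t \<le> (0 :: real)"
  proof eventually_elim
    case (elim t)
    then show ?case
      using assms(5)[of t] sum.remove[OF assms(2,3), of "\<lambda>i. frac_cost t (A i)"] by force
  qed
  then have "\<forall>\<^sub>F t :: real in at_top. False"
    using eventually_gt_at_top[of "0 :: real"] by eventually_elim simp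
  then show False
    by simp
qed

lemma frac_cost_mono:
  assumes "0 < frac_max c" and "frac_max c \<le> frac_max d" and "0 \<le> t"
  shows "frac_cost t c \<le> frac_cost t d"
  unfolding frac_cost_def using assms by (intro powr_mono2) auto

section \<open>Primality of the maxima and transfer of a prime\<close>

lemma reduced_frac_swap [simp]: "reduced_frac (prod.swap c) \<longleftrightarrow> reduced_frac c"
  by (auto simp: reduced_frac_def gcd.commute)

lemma reduced_frac_cases:
  assumes "reduced_frac c"
  obtains "c = (1, 1)" | "snd c < fst c" | "fst c < snd c"
proof (cases "fst c = snd c")
  case True
  then have "c = (1, 1)"
    using assms by (simp add: reduced_frac_def prod_eq_iff)
  then show ?thesis
    by (rule that(1))
next
  case False
  then show ?thesis
    using that(2,3) by linarith
qed

text \<open>A composite numerator r * s could be split off: r / 1 and s / \<open>snd (A k)\<close>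
  both have a smaller maximum than entry \<open>k\<close>.\<close>

lemma locally_minimal_fst_prime:
  assumes "locally_minimal A" and red: "reduced_frac (A k)" and less: "snd (A k) < fst (A k)"
  shows "prime (fst (A k))"
proof (rule ccontr)
  assume "\<not> prime (fst (A k))"
  moreover have "fst (A k) > 1"
    using red less by (simp add: reduced_frac_def)
  moreover from this obtain r where r: "prime r" "r dvd fst (A k)"
    using prime_factor_nat[of "fst (A k)"] by auto
  moreover from this obtain s where s: "fst (A k) = r * s"
    by auto
  ultimately have rs: "fst (A k) = r * s" "1 < r" "1 < s"
    using prime_gt_1_nat[OF r(1)] by (cases "s = 0"; cases "s = 1"; simp)+
  have lt: "r < fst (A k)" "s < fst (A k)"
    using rs by simp_all
  have "gcd s (snd (A k)) = 1"
    using red rs(1) by (simp add: reduced_frac_def del: One_nat_def flip: coprime_iff_gcd_eq_1)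
  then have "(\<Prod>i\<in>{k}. frac_val (A i) :: rat) \<noteq>
      prod_list (map frac_val ([] @ [(r, 1), (s, snd (A k))]))"
    using assms rs lt by (intro locally_minimal_no_exchange[of A _ k]) (auto simp: reduced_frac_def frac_max_def)
  then show False
    by (simp add: frac_val_def rs(1))
qed

lemma locally_minimal_frac_max_prime:
  assumes "locally_minimal A" and "reduced_frac (A k)" and "frac_max (A k) > 1"
  shows "prime (frac_max (A k))"
  using assms(2)
proof (cases rule: reduced_frac_cases)
  case 1
  with assms(3) show ?thesis
    by (simp add: frac_max_def)
next
  case 2
  then show ?thesis
    using locally_minimal_fst_prime[OF assms(1,2)] by (simp add: frac_max_def)
next
  case 3
  then have "prime (fst ((prod.swap \<circ> A) k))"
    using assms by (intro locally_minimal_fst_prime locally_minimal_swap) auto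
  with 3 show ?thesis
    by (simp add: frac_max_def)
qed

text \<open>The factor \<open>p\<close> moves from entry \<open>k\<close> to entry \<open>l\<close>, and the primes of \<open>s\<close> become separate entries:
  one entry with maximum \<open>p\<close> is traded for entries with smaller maxima.\<close>

lemma locally_minimal_no_transfer:
  assumes min: "locally_minimal A" and red: "\<And>i. reduced_frac (A i)" and p: "prime p"
    and k: "fst (A k) = p" "snd (A k) < p"
    and l: "fst (A l) = u * s" "u * p < snd (A l)" "gcd p (snd (A l)) = 1"
    and small: "\<And>q. prime q \<Longrightarrow> q dvd s \<Longrightarrow> q < p"
  shows False
proof -
  have pos: "fst (A i) > 0" "snd (A i) > 0" for i
    using red[of i] by (simp_all add: reduced_frac_def)
  have "u > 0" "s > 0"
    using pos(1)[of l] l(1) by auto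
  have "k \<noteq> l"
  proof
    assume "k = l"
    then have "u * p < p"
      using less_trans[OF l(2)] k(2) by simp
    then show False
      using \<open>u > 0\<close> by simp
  qed
  obtain qs where qs: "mset qs = prime_factorization s"
    using ex_mset by blast
  have qs_prime: "prime q \<and> q < p" if "q \<in> set qs" for q
  proof -
    have "q \<in># prime_factorization s"
      using that by (simp flip: qs)
    then show ?thesis
      using small by auto
  qed
  have "prod_list qs = s"
    using prod_mset_prime_factorization_nat[of s] \<open>s > 0\<close> by (simp add: prod_mset_prod_list flip: qs)
  then have prod: "prod_list (map (\<lambda>q. frac_val (q, 1)) qs) = (of_nat s :: rat)"
    by (induction qs arbitrary: s) (auto simp: frac_val_def)
  have "gcd (u * p) (snd (A l)) = 1"
    using l red[of l] by (simp add: reduced_frac_def del: One_nat_def flip: coprime_iff_gcd_eq_1)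
  moreover have "frac_cost t (u * p, snd (A l)) \<le> frac_cost t (A l)" if "t > 0" for t
    using l(2) that pos(2)[of l] by (intro frac_cost_mono) (auto simp: frac_max_def)
  \<comment> \<open>The new entry \<open>l\<close> still has maximum at most that of
    \<open>A l\<close>, because \<open>u * p\<close> is below the denominator. The remaining
    entries, \<open>(1, snd (A k))\<close> and the primes of \<open>s\<close>, have maxima below
    \<open>p\<close> and replace entry \<open>k\<close>.\<close>
  ultimately have "(\<Prod>i\<in>{k, l}. frac_val (A i) :: rat) \<noteq>
      prod_list (map frac_val ([(u * p, snd (A l))] @ (1, snd (A k)) # map (\<lambda>q. (q, 1)) qs))"
    using min k pos \<open>u > 0\<close> \<open>k \<noteq> l\<close> p prime_gt_1_nat[OF p]
    by (intro locally_minimal_no_exchange[of A _ k])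
       (auto simp: reduced_frac_def frac_max_def insert_Diff_if dest!: qs_prime dest: prime_gt_0_nat prime_gt_1_nat)
  moreover have "prod_list (map frac_val (map (\<lambda>q. (q, 1)) qs)) = (of_nat s :: rat)"
    using prod by (simp add: o_def)
  ultimately show False
    using k l pos \<open>k \<noteq> l\<close> by (simp add: frac_val_def o_def ac_simps)
qed

text \<open>\<open>C\<close> collects the primes of \<open>A\<close> that come before \<open>p\<close>, and possibly some copies of \<open>p\<close>.\<close>

locale prime_extension =
  fixes A C :: frac_seq and p :: nat
  assumes min: "locally_minimal A"
    and red_A: "reduced_frac (A i)"
    and coprime_A: "gcd (fst (A i)) (snd (A j)) = 1"
    and sorted_A: "frac_max (A (Suc i)) \<le> frac_max (A i)"
    and red_C: "reduced_frac (C i)"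
    and sorted_C: "frac_max (C (Suc i)) \<le> frac_max (C i)"
    and dvd_fst: "fst (C i) dvd fst (A i)" and dvd_snd: "snd (C i) dvd snd (A i)"
    and prime_p: "prime p"
    and rest_fst: "prime q \<Longrightarrow> q dvd fst (A i) div fst (C i) \<Longrightarrow> q \<le> p"
    and rest_snd: "prime q \<Longrightarrow> q dvd snd (A i) div snd (C i) \<Longrightarrow> q \<le> p"
    and used_fst: "prime q \<Longrightarrow> q dvd fst (C i) \<Longrightarrow> p \<le> q"
    and used_snd: "prime q \<Longrightarrow> q dvd snd (C i) \<Longrightarrow> p \<le> q"
begin

lemma pos: "fst (A i) > 0" "snd (A i) > 0" "fst (C i) > 0" "snd (C i) > 0"
  using red_A[of i] red_C[of i] by (simp_all add: reduced_frac_def)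

lemma fst_rest: "fst (A i) = fst (C i) * (fst (A i) div fst (C i))"
  using dvd_fst by simp

text \<open>The larger side of a nontrivial \<open>A k\<close> is prime. If it is the numerator, it
  equals \<open>p\<close>, and nothing of the denominator has been inserted, since inserted primes
  are at least \<open>p\<close>. If it is the denominator, the hypotheses conflict.\<close>

lemma new_entry:
  assumes "p dvd fst (A k) div fst (C k)" and "\<not> fst (C k) * p < snd (C k)"
  shows "fst (A k) = p \<and> snd (A k) < p \<and> C k = (1, 1)"
  using red_A[of k]
proof (cases rule: reduced_frac_cases)
  case 1
  then show ?thesis
    using assms(1) prime_p dvd_fst[of k] by auto
next
  case 2
  then have "prime (fst (A k))"
    using locally_minimal_fst_prime[OF min red_A] by blast
  moreover have "p dvd fst (A k)"
    using assms(1) fst_rest[of k] by (metis dvd_mult)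
  ultimately have p: "fst (A k) = p"
    using prime_p primes_dvd_imp_eq by blast
  obtain m where "fst (A k) div fst (C k) = p * m"
    using assms(1) by blast
  then have "p = p * (fst (C k) * m)"
    using fst_rest[of k] p by (simp add: ac_simps)
  then have 1: "fst (C k) = 1"
    using prime_gt_0_nat[OF prime_p] by simp
  have "snd (C k) = 1"
  proof (rule ccontr)
    assume "snd (C k) \<noteq> 1"
    then obtain q where q: "prime q" "q dvd snd (C k)"
      using prime_factor_nat by blast
    then have "q \<le> snd (A k)"
      using dvd_snd[of k] pos(2)[of k] by (meson dvd_imp_le dvd_trans)
    then show False
      using used_snd[OF q] p 2 by simp
  qed
  with 1 2 p show ?thesis
    by (simp add: prod_eq_iff)
next
  case 3
  have le: "fst (C k) * p \<le> fst (A k)"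
    using assms(1) fst_rest[of k] pos(1)[of k] by (metis dvd_imp_le mult_dvd_mono dvd_refl)
  have "prime (fst ((prod.swap \<circ> A) k))"
    using 3 red_A by (intro locally_minimal_fst_prime locally_minimal_swap min) auto
  then have prime: "prime (snd (A k))"
    by simp
  \<comment> \<open>Either the prime \<open>snd (A k)\<close> is still missing, hence at most
    \<open>p\<close>, and cannot exceed \<open>fst (A k)\<close>; or it already stands in
    \<open>C k\<close>, and then there is room for \<open>p\<close> below it, contrary to the second
    hypothesis.\<close>
  then consider "snd (C k) = 1" | "snd (C k) = snd (A k)"
    using dvd_snd[of k] by (auto simp: prime_nat_iff)
  then show ?thesis
  proof cases
    case 1
    then have "snd (A k) \<le> p"
      using rest_snd[OF prime, of k] by simp
    also have "p \<le> fst (C k) * p"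
      using pos(3)[of k] by simp
    finally show ?thesis
      using le 3 by simp
  next
    case 2
    then show ?thesis
      using assms(2) le 3 by simp
  qed
qed

text \<open>\<open>epsilon\<close> opens the first free position, so \<open>A\<close> must have
  \<open>p\<close> exactly there. The least free position \<open>l\<close> at which \<open>A\<close>
  has numerator \<open>p\<close> works: \<open>C\<close> is sorted, hence trivial from
  \<open>l\<close> on.\<close>

lemma frac_length_eq:
  assumes "fst (A k) = p" and "C k = (1, 1)"
  shows "fst (A (frac_length C)) = p \<and> C (frac_length C) = (1, 1)"
proof -
  define l where "l = (LEAST k. fst (A k) = p \<and> C k = (1, 1))"
  have l: "fst (A l) = p" "C l = (1, 1)"
    using LeastI[of "\<lambda>k. fst (A k) = p \<and> C k = (1, 1)" k] assms by (simp_all add: l_def)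
  have "frac_length C = l"
    unfolding frac_length_def
  proof (rule Least_equality)
    have "frac_max (C i) \<le> frac_max (C l)" if "i \<ge> l" for i
      using lift_Suc_antimono_le[of "\<lambda>i. frac_max (C i)", OF sorted_C that] .
    then have "fst (C i) \<le> 1 \<and> snd (C i) \<le> 1" if "i \<ge> l" for i
      using that l by (simp add: frac_max_def)
    then show "\<forall>i\<ge>l. C i = (1, 1)"
      using pos(3,4) by (metis One_nat_def Suc_leI le_antisym prod.collapse)
  next
    fix i assume i: "\<forall>j\<ge>i. C j = (1, 1)"
    show "l \<le> i"
    proof (rule ccontr)
      assume "\<not> l \<le> i"
      \<comment> \<open>If \<open>C\<close> were already trivial from \<open>i\<close> <
        \<open>l\<close> on, the maximum of \<open>A i\<close> would be a prime not yet inserted and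
        at least \<open>p\<close>, so \<open>p\<close> itself. In the numerator this contradicts the
        choice of \<open>l\<close>, in the denominator the coprimality with
        \<open>A l\<close>.\<close>
      have "frac_max (A l) \<le> frac_max (A i)"
        using lift_Suc_antimono_le[of "\<lambda>i. frac_max (A i)", OF sorted_A] \<open>\<not> l \<le> i\<close> by simp
      then have ge: "p \<le> frac_max (A i)"
        using l by (simp add: frac_max_def)
      then have prime: "prime (frac_max (A i))"
        using locally_minimal_frac_max_prime[OF min red_A] prime_gt_1_nat[OF prime_p] by simp
      have C: "C i = (1, 1)"
        using i by simp
      have "frac_max (A i) = fst (A i) \<or> frac_max (A i) = snd (A i)"
        by (simp add: frac_max_def max_def)
      then show False
      proof
        assume "frac_max (A i) = fst (A i)"
        then have "fst (A i) = p"
          using rest_fst[of "fst (A i)" i] prime ge C by simp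
        then show False
          using not_less_Least[of i "\<lambda>k. fst (A k) = p \<and> C k = (1, 1)"] C \<open>\<not> l \<le> i\<close>
          by (simp add: l_def)
      next
        assume "frac_max (A i) = snd (A i)"
        then have "snd (A i) = p"
          using rest_snd[of "snd (A i)" i] prime ge C by simp
        then show False
          using coprime_A[of l i] l prime_p by simp
      qed
    qed
  qed
  with l show ?thesis
    by simp
qed

text \<open>The alternatives mirror the canonical rule: a \<open>delta\<close> move that stays
  compatible with \<open>A\<close>, or \<open>delta\<close> is empty and the \<open>epsilon\<close>
  move is compatible.\<close>

lemma extension:
  assumes "p dvd fst (A k) div fst (C k)"
  shows "(\<exists>k. fst (C k) * p < snd (C k) \<and> fst (C k) * p dvd fst (A k)) \<or>
    (\<forall>k. \<not> fst (C k) * p < snd (C k)) \<and>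
      fst (A (frac_length C)) = p \<and> C (frac_length C) = (1, 1)"
proof (cases "\<exists>k. fst (C k) * p < snd (C k) \<and> fst (C k) * p dvd fst (A k)")
  case no: False
  have not_dvd: "\<not> p dvd fst (A i) div fst (C i)" if "fst (C i) * p < snd (C i)" for i
    using no that fst_rest[of i] by (metis dvd_refl mult_dvd_mono)
  have k: "fst (A k) = p \<and> snd (A k) < p \<and> C k = (1, 1)"
    using new_entry[OF assms] not_dvd assms by blast
  \<comment> \<open>An entry \<open>l\<close> open to \<open>delta\<close> receives \<open>p\<close>
    from entry \<open>k\<close>; the part \<open>s\<close> split off is what
    \<open>fst (C l)\<close> still lacks. It is free of \<open>p\<close>, since otherwise the
    \<open>delta\<close> move at \<open>l\<close> would be compatible with \<open>A\<close>.\<close>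
  have "False" if l: "fst (C l) * p < snd (C l)" for l
  proof (rule locally_minimal_no_transfer[OF min red_A prime_p, of k l])
    show "fst (A l) = fst (C l) * (fst (A l) div fst (C l))"
      by (rule fst_rest)
    show "fst (C l) * p < snd (A l)"
      using l dvd_snd[of l] pos(2)[of l] by (meson dvd_imp_le less_le_trans)
    show "gcd p (snd (A l)) = 1"
      using coprime_A[of k l] k by simp
    show "q < p" if "prime q" "q dvd fst (A l) div fst (C l)" for q
      using rest_fst[OF that] not_dvd[OF l] that(2) by (cases "q = p") auto
  qed (use k in auto)
  then show ?thesis
    using frac_length_eq k by blast
qed blast

text \<open>The locale is symmetric in numerators and denominators, so its results also serve the
  primes of the denominator.\<close>

lemma swap: "prime_extension (prod.swap \<circ> A) (prod.swap \<circ> C) p"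
  using locally_minimal_swap[OF min] red_A coprime_A sorted_A red_C sorted_C dvd_fst dvd_snd
    prime_p rest_fst rest_snd used_fst used_snd
  by unfold_locales (auto simp: gcd.commute frac_max_def max.commute)

end

section \<open>Factorizations of the partial products\<close>

text \<open>With \<open>den_factor\<close>, this turns the exponents 1 and -1 into two products of
  natural numbers, to which divisibility applies.\<close>

definition num_factor :: "rat \<Rightarrow> nat \<Rightarrow> nat" where
  "num_factor \<alpha> i = (if prime_at \<alpha> i dvd rat_num \<alpha> then prime_at \<alpha> i else 1)"

definition den_factor :: "rat \<Rightarrow> nat \<Rightarrow> nat" where
  "den_factor \<alpha> i = (if prime_at \<alpha> i dvd rat_num \<alpha> then 1 else prime_at \<alpha> i)"

lemma prime_at_prime:
  assumes "i \<in> {1..num_primes \<alpha>}"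
  shows "prime (prime_at \<alpha> i)"
proof -
  have "prime_at \<alpha> i \<in> set (prime_list \<alpha>)"
    unfolding prime_at_def using assms by (intro nth_mem) auto
  then show ?thesis
    by (auto simp: prime_list_def)
qed

lemma prime_at_antimono:
  assumes "1 \<le> i" and "i \<le> j" and "j \<le> num_primes \<alpha>"
  shows "prime_at \<alpha> j \<le> prime_at \<alpha> i"
proof -
  have "sorted_wrt (\<ge>) (prime_list \<alpha>)"
    by (simp add: prime_list_def sorted_wrt_rev)
  then show ?thesis
    using assms sorted_wrt_nth_less[of "(\<ge>)" "prime_list \<alpha>" "i - 1" "j - 1"]
    by (cases "i = j") (auto simp: prime_at_def)
qed

lemma partial_rat_Suc:
  "partial_rat \<alpha> (Suc i) =
     partial_rat \<alpha> i * (of_nat (num_factor \<alpha> (Suc i)) / of_nat (den_factor \<alpha> (Suc i)))"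
  by (simp add: partial_rat_def num_factor_def den_factor_def prime_sign_def field_simps)

lemma partial_rat_eq:
  "partial_rat \<alpha> i =
     of_nat (\<Prod>j=1..i. num_factor \<alpha> j) / of_nat (\<Prod>j=1..i. den_factor \<alpha> j)"
proof (induction i)
  case 0
  show ?case by (simp add: partial_rat_def)
next
  case (Suc i)
  show ?case
    unfolding partial_rat_Suc Suc.IH by simp
qed

text \<open>The side of a prime depends on its value only, so equal primes never meet on opposite
  sides, and distinct primes are coprime.\<close>

lemma num_den_factor_coprime:
  assumes "i \<in> {1..num_primes \<alpha>}" and "j \<in> {1..num_primes \<alpha>}"
  shows "coprime (num_factor \<alpha> i) (den_factor \<alpha> j)"
  using primes_coprime[OF prime_at_prime[OF assms(1)] prime_at_prime[OF assms(2)]]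
  by (cases "prime_at \<alpha> i = prime_at \<alpha> j") (auto simp: num_factor_def den_factor_def)

lemma prime_dvd_factor:
  assumes "prime q" and "I \<subseteq> {1..num_primes \<alpha>}"
    and "q dvd (\<Prod>j\<in>I. num_factor \<alpha> j) \<or> q dvd (\<Prod>j\<in>I. den_factor \<alpha> j)"
  shows "\<exists>j\<in>I. q = prime_at \<alpha> j"
proof -
  have "finite I"
    using assms(2) finite_subset by blast
  then obtain j where j: "j \<in> I" "q dvd num_factor \<alpha> j \<or> q dvd den_factor \<alpha> j"
    using assms(1,3) by (auto simp: prime_dvd_prod_iff)
  moreover have "\<not> q dvd 1"
    using assms(1) not_prime_unit by blast
  ultimately have "q dvd prime_at \<alpha> j"
    by (auto simp: num_factor_def den_factor_def split: if_splits)
  moreover have "prime (prime_at \<alpha> j)"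
    using j(1) assms(2) by (intro prime_at_prime) blast
  ultimately show ?thesis
    using primes_dvd_imp_eq[OF assms(1)] j(1) by blast
qed

lemma factorization_prod:
  assumes "factorization \<beta> C" and "finite S" and "frac_supp C \<subseteq> S"
  shows "(\<Prod>k\<in>S. frac_val (C k)) = \<beta>"
proof -
  have "(\<Prod>k\<in>frac_supp C. frac_val (C k)) = (\<Prod>k\<in>S. frac_val (C k) :: rat)"
    using assms(2,3) by (intro prod.mono_neutral_left) auto
  then show ?thesis
    using assms(1) by (simp add: factorization_def)
qed

text \<open>Both fractions for the partial product are in lowest terms, so they agree in numerator
  and denominator. Allowing any finite \<open>S\<close> around the support lets two factorizations
  be compared over one index set.\<close>

lemma factorization_partial_prod:
  assumes fact: "factorization (partial_rat \<alpha> i) C" and i: "i \<le> num_primes \<alpha>"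
    and S: "finite S" "frac_supp C \<subseteq> S"
  shows "(\<Prod>k\<in>S. fst (C k)) = (\<Prod>j=1..i. num_factor \<alpha> j)"
    and "(\<Prod>k\<in>S. snd (C k)) = (\<Prod>j=1..i. den_factor \<alpha> j)"
proof -
  define a b c d where "a = (\<Prod>k\<in>S. fst (C k))" and "b = (\<Prod>k\<in>S. snd (C k))"
    and "c = (\<Prod>j=1..i. num_factor \<alpha> j)" and "d = (\<Prod>j=1..i. den_factor \<alpha> j)"
  have "coprime a b"
    unfolding a_def b_def using fact
    by (intro prod_coprime_left prod_coprime_right) (simp add: factorization_def coprime_iff_gcd_eq_1)
  moreover have "coprime c d"
    unfolding c_def d_def using i
    by (intro prod_coprime_left prod_coprime_right num_den_factor_coprime) auto
  moreover have "b > 0" "d > 0"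
    using fact i prime_gt_0_nat[OF prime_at_prime]
    by (auto simp: b_def d_def factorization_def den_factor_def intro!: prod_pos)
  moreover have "(of_nat a / of_nat b :: rat) = of_nat c / of_nat d"
    using factorization_prod[OF fact S] partial_rat_eq[of \<alpha> i]
    unfolding a_def b_def c_def d_def frac_val_def by (simp add: prod_dividef)
  ultimately have "a * d = c * b"
    by (simp add: field_simps flip: of_nat_mult)
  moreover have "a * d = c * b \<longleftrightarrow> a = c \<and> d = b"
    using \<open>coprime a b\<close> \<open>coprime c d\<close> by (rule coprime_crossproduct_nat)
  ultimately show "(\<Prod>k\<in>S. fst (C k)) = (\<Prod>j=1..i. num_factor \<alpha> j)"
    and "(\<Prod>k\<in>S. snd (C k)) = (\<Prod>j=1..i. den_factor \<alpha> j)"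
    by (simp_all add: a_def b_def c_def d_def)
qed

text \<open>The invariant of the descent through the tree: every prime inserted so far stands where
  \<open>A\<close> has it.\<close>

definition frac_dvd :: "frac_seq \<Rightarrow> frac_seq \<Rightarrow> bool" where
  "frac_dvd C A \<longleftrightarrow> (\<forall>k. fst (C k) dvd fst (A k) \<and> snd (C k) dvd snd (A k))"

text \<open>Dividing the product formula for \<open>A\<close> by that for \<open>C\<close> shows
  that what is missing in \<open>C\<close> consists exactly of the primes with indices from
  \<open>Suc i\<close> to \<open>n\<close>.\<close>

lemma frac_dvd_rest_prod:
  assumes A: "factorization (partial_rat \<alpha> n) A" and C: "factorization (partial_rat \<alpha> i) C"
    and le: "i \<le> n" "n \<le> num_primes \<alpha>" and dvd: "frac_dvd C A"
    and S: "finite S" "frac_supp A \<union> frac_supp C \<subseteq> S"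
  shows "(\<Prod>k\<in>S. fst (A k) div fst (C k)) = (\<Prod>j=Suc i..n. num_factor \<alpha> j)"
    and "(\<Prod>k\<in>S. snd (A k) div snd (C k)) = (\<Prod>j=Suc i..n. den_factor \<alpha> j)"
proof -
  have split: "(\<Prod>j=1..n. f j) = (\<Prod>j=1..i. f j) * (\<Prod>j=Suc i..n. f j)" for f :: "nat \<Rightarrow> nat"
    using prod.ub_add_nat[of 1 i f "n - i"] le(1) by simp
  have pos: "fst (C k) > 0" "snd (C k) > 0" for k
    using C by (auto simp: factorization_def)
  have "(\<Prod>k\<in>S. fst (C k)) * (\<Prod>k\<in>S. fst (A k) div fst (C k)) = (\<Prod>k\<in>S. fst (A k))"
    using dvd by (simp add: frac_dvd_def flip: prod.distrib)
  moreover have "(\<Prod>k\<in>S. fst (A k)) = (\<Prod>k\<in>S. fst (C k)) * (\<Prod>j=Suc i..n. num_factor \<alpha> j)"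
    using factorization_partial_prod(1)[OF A le(2) S(1)] factorization_partial_prod(1)[OF C _ S(1)]
      le S(2) split[of "num_factor \<alpha>"] by simp
  moreover have "(\<Prod>k\<in>S. fst (C k)) > 0"
    using pos by (intro prod_pos) auto
  ultimately show "(\<Prod>k\<in>S. fst (A k) div fst (C k)) = (\<Prod>j=Suc i..n. num_factor \<alpha> j)"
    by simp
  have "(\<Prod>k\<in>S. snd (C k)) * (\<Prod>k\<in>S. snd (A k) div snd (C k)) = (\<Prod>k\<in>S. snd (A k))"
    using dvd by (simp add: frac_dvd_def flip: prod.distrib)
  moreover have "(\<Prod>k\<in>S. snd (A k)) = (\<Prod>k\<in>S. snd (C k)) * (\<Prod>j=Suc i..n. den_factor \<alpha> j)"
    using factorization_partial_prod(2)[OF A le(2) S(1)] factorization_partial_prod(2)[OF C _ S(1)]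
      le S(2) split[of "den_factor \<alpha>"] by simp
  moreover have "(\<Prod>k\<in>S. snd (C k)) > 0"
    using pos by (intro prod_pos) auto
  ultimately show "(\<Prod>k\<in>S. snd (A k) div snd (C k)) = (\<Prod>j=Suc i..n. den_factor \<alpha> j)"
    by simp
qed

lemma prime_dvd_rest:
  assumes A: "factorization (partial_rat \<alpha> n) A" and C: "factorization (partial_rat \<alpha> i) C"
    and le: "i \<le> n" "n \<le> num_primes \<alpha>" and dvd: "frac_dvd C A"
    and q: "prime q" "q dvd fst (A k) div fst (C k) \<or> q dvd snd (A k) div snd (C k)"
  shows "\<exists>j\<in>{Suc i..n}. q = prime_at \<alpha> j"
proof -
  define S where "S = insert k (frac_supp A \<union> frac_supp C)"
  have S: "finite S" "frac_supp A \<union> frac_supp C \<subseteq> S" "k \<in> S"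
    using A C by (auto simp: S_def factorization_def)
  have "q dvd (\<Prod>j=Suc i..n. num_factor \<alpha> j) \<or> q dvd (\<Prod>j=Suc i..n. den_factor \<alpha> j)"
    unfolding frac_dvd_rest_prod[OF A C le dvd S(1,2), symmetric]
    using q(2) dvd_prodI[OF S(1,3), of "\<lambda>k. fst (A k) div fst (C k)"]
      dvd_prodI[OF S(1,3), of "\<lambda>k. snd (A k) div snd (C k)"] dvd_trans[of q] by metis
  then show ?thesis
    using le(2) by (intro prime_dvd_factor q(1)) auto
qed

lemma prime_dvd_used:
  assumes C: "factorization (partial_rat \<alpha> i) C" and i: "i \<le> num_primes \<alpha>"
    and q: "prime q" "q dvd fst (C k) \<or> q dvd snd (C k)"
  shows "\<exists>j\<in>{1..i}. q = prime_at \<alpha> j"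
proof -
  define S where "S = insert k (frac_supp C)"
  have S: "finite S" "frac_supp C \<subseteq> S" "k \<in> S"
    using C by (auto simp: S_def factorization_def)
  have "q dvd (\<Prod>j=1..i. num_factor \<alpha> j) \<or> q dvd (\<Prod>j=1..i. den_factor \<alpha> j)"
    unfolding factorization_partial_prod[OF C i S(1,2), symmetric]
    using q(2) dvd_prodI[OF S(1,3), of "\<lambda>k. fst (C k)"]
      dvd_prodI[OF S(1,3), of "\<lambda>k. snd (C k)"] dvd_trans[of q] by metis
  then show ?thesis
    using i by (intro prime_dvd_factor q(1)) auto
qed

text \<open>Membership in the tree only says that a label factors some partial product; comparing
  values with the parent identifies which one.\<close>

lemma factorization_update_value:
  assumes C: "factorization \<beta> C" and C': "factorization \<beta>' (C(k := c))"
    and eq: "frac_val c = frac_val (C k) * x"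
  shows "factorization (\<beta> * x) (C(k := c))"
proof -
  define S where "S = insert k (frac_supp C)"
  have S: "finite S" "frac_supp C \<subseteq> S" "frac_supp (C(k := c)) \<subseteq> S" "k \<in> S"
    using C by (auto simp: S_def factorization_def)
  have "\<beta>' = frac_val c * (\<Prod>i\<in>S - {k}. frac_val (C i))"
    using factorization_prod[OF C' S(1,3)] prod.remove[OF S(1,4), of "\<lambda>i. frac_val ((C(k := c)) i) :: rat"]
    by simp
  moreover have "\<beta> = frac_val (C k) * (\<Prod>i\<in>S - {k}. frac_val (C i))"
    using factorization_prod[OF C S(1,2)] prod.remove[OF S(1,4), of "\<lambda>i. frac_val (C i) :: rat"] by simp
  ultimately have "\<beta>' = \<beta> * x"
    using eq by simp
  then show ?thesis
    using C' by simp
qed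

section \<open>The canonical move for the next prime\<close>

lemma frac_length_swap: "frac_length (prod.swap \<circ> C) = frac_length C"
proof -
  have "prod.swap c = (1, 1) \<longleftrightarrow> c = (1, 1)" for c :: "nat \<times> nat"
    by (cases c) auto
  then show ?thesis
    by (simp add: frac_length_def)
qed

text \<open>The next prime divides the product of everything missing on its side, hence one of the
  quotients.\<close>

lemma dvd_rest_ex:
  assumes A: "factorization (partial_rat \<alpha> n) A" and C: "factorization (partial_rat \<alpha> i) C"
    and le: "i < n" "n \<le> num_primes \<alpha>" and dvd: "frac_dvd C A"
  shows "if prime_at \<alpha> (Suc i) dvd rat_num \<alpha>
    then \<exists>k. prime_at \<alpha> (Suc i) dvd fst (A k) div fst (C k)
    else \<exists>k. prime_at \<alpha> (Suc i) dvd snd (A k) div snd (C k)"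
proof -
  define S where "S = frac_supp A \<union> frac_supp C"
  have S: "finite S" "frac_supp A \<union> frac_supp C \<subseteq> S"
    using A C by (auto simp: S_def factorization_def)
  have prime: "prime (prime_at \<alpha> (Suc i))"
    using le by (intro prime_at_prime) auto
  have "num_factor \<alpha> (Suc i) dvd (\<Prod>k\<in>S. fst (A k) div fst (C k))"
    "den_factor \<alpha> (Suc i) dvd (\<Prod>k\<in>S. snd (A k) div snd (C k))"
    unfolding frac_dvd_rest_prod[OF A C less_imp_le[OF le(1)] le(2) dvd S]
    using le(1) by (auto intro!: dvd_prodI)
  then show ?thesis
    using prime S(1) by (auto simp: num_factor_def den_factor_def prime_dvd_prod_iff)
qed

text \<open>The decreasing order of the primes supplies the bounds: missing primes have index at
  least \<open>Suc i\<close>, inserted ones at most \<open>i\<close>.\<close>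

lemma prime_extension_partial:
  assumes A: "factorization (partial_rat \<alpha> n) A" and C: "factorization (partial_rat \<alpha> i) C"
    and le: "i < n" "n \<le> num_primes \<alpha>" and dvd: "frac_dvd C A" and min: "locally_minimal A"
  shows "prime_extension A C (prime_at \<alpha> (Suc i))"
proof
  show "prime (prime_at \<alpha> (Suc i))"
    using le by (intro prime_at_prime) auto
  have rest: "q \<le> prime_at \<alpha> (Suc i)"
    if "prime q" "q dvd fst (A k) div fst (C k) \<or> q dvd snd (A k) div snd (C k)" for q k
    using prime_dvd_rest[OF A C _ le(2) dvd that] prime_at_antimono[of "Suc i" _ \<alpha>] le by force
  then show "q \<le> prime_at \<alpha> (Suc i)" if "prime q" "q dvd fst (A k) div fst (C k)" for q k
    using that by blast
  show "q \<le> prime_at \<alpha> (Suc i)" if "prime q" "q dvd snd (A k) div snd (C k)" for q k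
    using rest that by blast
  have used: "prime_at \<alpha> (Suc i) \<le> q" if "prime q" "q dvd fst (C k) \<or> q dvd snd (C k)" for q k
    using prime_dvd_used[OF C _ that] prime_at_antimono[of _ "Suc i" \<alpha>] le by force
  then show "prime_at \<alpha> (Suc i) \<le> q" if "prime q" "q dvd fst (C k)" for q k
    using that by blast
  show "prime_at \<alpha> (Suc i) \<le> q" if "prime q" "q dvd snd (C k)" for q k
    using used that by blast
qed (use A C dvd min factorization_reduced[OF A] factorization_reduced[OF C]
     in \<open>auto simp: factorization_def frac_dvd_def frac_max_def\<close>)

lemma frac_dvd_update:
  assumes "frac_dvd C A" and "fst c dvd fst (A k)" and "snd c dvd snd (A k)"
  shows "frac_dvd (C(k := c)) A"
  using assms by (auto simp: frac_dvd_def)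

text \<open>The induction step. The ratio of values is recorded so that
  \<open>factorization_update_value\<close> can identify the new label as a factorization of the
  next partial product.\<close>

lemma canonical_extension:
  assumes A: "factorization (partial_rat \<alpha> n) A" and C: "factorization (partial_rat \<alpha> i) C"
    and le: "i < n" "n \<le> num_primes \<alpha>" and dvd: "frac_dvd C A" and min: "locally_minimal A"
  shows "\<exists>k c. C(k := c) \<in> (if delta \<alpha> i C \<noteq> {} then delta \<alpha> i C else epsilon \<alpha> i C) \<and>
    frac_dvd (C(k := c)) A \<and>
    frac_val c = frac_val (C k) *
      (of_nat (num_factor \<alpha> (Suc i)) / of_nat (den_factor \<alpha> (Suc i)) :: rat)"
proof -
  define p where "p = prime_at \<alpha> (Suc i)"
  interpret prime_extension A C p
    unfolding p_def using assms by (rule prime_extension_partial)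
  interpret sw: prime_extension "prod.swap \<circ> A" "prod.swap \<circ> C" p
    by (rule swap)
  show ?thesis
  proof (cases "p dvd rat_num \<alpha>")
    case True
    then have delta: "delta \<alpha> i C = {C(k := (fst (C k) * p, snd (C k))) | k. fst (C k) * p < snd (C k)}"
      and epsilon: "epsilon \<alpha> i C = {C(frac_length C := (p, 1))}"
      and factor: "num_factor \<alpha> (Suc i) = p" "den_factor \<alpha> (Suc i) = 1"
      by (simp_all add: delta_def epsilon_def num_factor_def den_factor_def p_def Let_def)
    obtain k0 where "p dvd fst (A k0) div fst (C k0)"
      using dvd_rest_ex[OF A C le dvd] True by (auto simp: p_def)
    from extension[OF this] show ?thesis
    proof
      assume "\<exists>k. fst (C k) * p < snd (C k) \<and> fst (C k) * p dvd fst (A k)"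
      then obtain k where k: "fst (C k) * p < snd (C k)" "fst (C k) * p dvd fst (A k)"
        by blast
      then have "C(k := (fst (C k) * p, snd (C k))) \<in> delta \<alpha> i C"
        unfolding delta by blast
      moreover from this have "delta \<alpha> i C \<noteq> {}"
        by blast
      moreover have "frac_dvd (C(k := (fst (C k) * p, snd (C k)))) A"
        using dvd k dvd_snd by (intro frac_dvd_update) auto
      ultimately show ?thesis
        unfolding factor
        by (intro exI[of _ k] exI[of _ "(fst (C k) * p, snd (C k))"]) (simp add: frac_val_def)
    next
      assume new: "(\<forall>k. \<not> fst (C k) * p < snd (C k)) \<and>
        fst (A (frac_length C)) = p \<and> C (frac_length C) = (1, 1)"
      then have "delta \<alpha> i C = {}"
        unfolding delta by blast
      moreover have "frac_dvd (C(frac_length C := (p, 1))) A"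
        using dvd new by (intro frac_dvd_update) auto
      ultimately show ?thesis
        unfolding factor epsilon using new
        by (intro exI[of _ "frac_length C"] exI[of _ "(p, 1)"]) (simp add: frac_val_def)
    qed
  next
    case False
    then have delta: "delta \<alpha> i C = {C(k := (fst (C k), snd (C k) * p)) | k. snd (C k) * p < fst (C k)}"
      and epsilon: "epsilon \<alpha> i C = {C(frac_length C := (1, p))}"
      and factor: "num_factor \<alpha> (Suc i) = 1" "den_factor \<alpha> (Suc i) = p"
      by (simp_all add: delta_def epsilon_def num_factor_def den_factor_def p_def Let_def)
    \<comment> \<open>A prime of the denominator is a prime of the numerator for the swapped
      sequences, so \<open>extension\<close> is applied there.\<close>
    obtain k0 where "p dvd fst ((prod.swap \<circ> A) k0) div fst ((prod.swap \<circ> C) k0)"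
      using dvd_rest_ex[OF A C le dvd] False by (auto simp: p_def)
    from sw.extension[OF this] show ?thesis
      unfolding frac_length_swap
    proof
      assume "\<exists>k. fst ((prod.swap \<circ> C) k) * p < snd ((prod.swap \<circ> C) k) \<and>
        fst ((prod.swap \<circ> C) k) * p dvd fst ((prod.swap \<circ> A) k)"
      then obtain k where k: "snd (C k) * p < fst (C k)" "snd (C k) * p dvd snd (A k)"
        by auto
      then have "C(k := (fst (C k), snd (C k) * p)) \<in> delta \<alpha> i C"
        unfolding delta by blast
      moreover from this have "delta \<alpha> i C \<noteq> {}"
        by blast
      moreover have "frac_dvd (C(k := (fst (C k), snd (C k) * p))) A"
        using dvd k dvd_fst by (intro frac_dvd_update) auto
      ultimately show ?thesis
        unfolding factor
        by (intro exI[of _ k] exI[of _ "(fst (C k), snd (C k) * p)"]) (simp add: frac_val_def)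
    next
      assume "(\<forall>k. \<not> fst ((prod.swap \<circ> C) k) * p < snd ((prod.swap \<circ> C) k)) \<and>
        fst ((prod.swap \<circ> A) (frac_length C)) = p \<and> (prod.swap \<circ> C) (frac_length C) = (1, 1)"
      then have new: "\<forall>k. \<not> snd (C k) * p < fst (C k)" "snd (A (frac_length C)) = p"
        "C (frac_length C) = (1, 1)"
        by (auto simp: prod_eq_iff)
      then have "delta \<alpha> i C = {}"
        unfolding delta by blast
      moreover have "frac_dvd (C(frac_length C := (1, p))) A"
        using dvd new by (intro frac_dvd_update) auto
      ultimately show ?thesis
        unfolding factor epsilon using new
        by (intro exI[of _ "frac_length C"] exI[of _ "(1, p)"]) (simp add: frac_val_def)
    qed
  qed
qed

text \<open>For equal indices the set of missing primes is empty, so all quotients are 1.\<close>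

lemma frac_dvd_eq:
  assumes A: "factorization (partial_rat \<alpha> n) A" and C: "factorization (partial_rat \<alpha> n) C"
    and n: "n \<le> num_primes \<alpha>" and dvd: "frac_dvd C A"
  shows "C = A"
proof
  fix k
  have "\<not> q dvd fst (A k) div fst (C k) \<and> \<not> q dvd snd (A k) div snd (C k)" if "prime q" for q
    using prime_dvd_rest[OF A C order.refl n dvd that, of k] by auto
  then have "fst (A k) div fst (C k) = 1" "snd (A k) div snd (C k) = 1"
    using prime_factor_nat by blast+
  then show "C k = A k"
    using dvd unfolding frac_dvd_def prod_eq_iff by (metis dvd_mult_div_cancel mult.right_neutral)
qed

section \<open>Optimal factorizations in the canonical tree\<close>

context canonical_optimal_factorization_tree
begin

text \<open>One level is descended per prime, always to a child whose label divides \<open>A\<close>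
  entrywise; at level \<open>n\<close> divisibility becomes equality.\<close>

lemma locally_minimal_in_labels:
  assumes A: "factorization (partial_rat \<alpha> n) A" and n: "n \<le> num_primes \<alpha>"
    and min: "locally_minimal A"
  shows "A \<in> \<nu> ` V"
proof -
  have "\<exists>r\<in>V. factorization (partial_rat \<alpha> i) (\<nu> r) \<and> frac_dvd (\<nu> r) A" if "i \<le> n" for i
    using that
  proof (induction i)
    case 0
    have "factorization (partial_rat \<alpha> 0) (\<lambda>_. (1, 1))" "frac_dvd (\<lambda>_. (1, 1)) A"
      by (simp_all add: factorization_def partial_rat_def frac_dvd_def)
    then show ?case
      using root_in label_root by (intro bexI[of _ r\<^sub>0]) auto
  next
    case (Suc i)
    then obtain r where r: "r \<in> V" "factorization (partial_rat \<alpha> i) (\<nu> r)" "frac_dvd (\<nu> r) A"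
      by auto
    have i: "i < n" "i < num_primes \<alpha>"
      using Suc.prems n by simp_all
    obtain k c where kc:
      "(\<nu> r)(k := c) \<in>
        (if delta \<alpha> i (\<nu> r) \<noteq> {} then delta \<alpha> i (\<nu> r) else epsilon \<alpha> i (\<nu> r))"
      "frac_dvd ((\<nu> r)(k := c)) A"
      "frac_val c = frac_val (\<nu> r k) *
        (of_nat (num_factor \<alpha> (Suc i)) / of_nat (den_factor \<alpha> (Suc i)) :: rat)"
      using canonical_extension[OF A r(2) i(1) n r(3) min] by blast
    have "(\<nu> r)(k := c) \<in> \<nu> ` children r"
      using kc(1) labels_children[OF r(1) has_child[OF r(1) i(2) r(2)] i(2) r(2)] by simp
    then obtain s where s: "s \<in> V" "\<nu> s = (\<nu> r)(k := c)"
      by (auto simp: children_def)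
    \<comment> \<open>The index \<open>m\<close> is unknown here; the value of the updated entry
      shows that the partial product is the one with index \<open>Suc i\<close>.\<close>
    then obtain m where "factorization (partial_rat \<alpha> m) ((\<nu> r)(k := c))"
      using label_in[OF s(1)] by (auto simp: factorization_set_def)
    from factorization_update_value[OF r(2) this kc(3)]
    have "factorization (partial_rat \<alpha> (Suc i)) (\<nu> s)"
      unfolding partial_rat_Suc s(2) .
    then show ?case
      using s(1) kc(2)[folded s(2)] by blast
  qed
  then obtain r where "r \<in> V" "factorization (partial_rat \<alpha> n) (\<nu> r)" "frac_dvd (\<nu> r) A"
    by blast
  then show ?thesis
    using frac_dvd_eq[OF A _ n] by blast
qed

end

theorem theorem3p7:
  fixes \<alpha> :: rat and V :: "'v set" and r\<^sub>0 :: 'v and \<phi> :: "'v \<Rightarrow> 'v" and \<nu> :: "'v \<Rightarrow> frac_seq"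
    and n :: nat and A :: frac_seq
  assumes "\<alpha> > 0"
    and "canonical_optimal_factorization_tree V r\<^sub>0 \<phi> \<alpha> \<nu>"
    and "separation_index \<alpha> n"
    and "optimal_factorization (partial_rat \<alpha> n) A"
  shows "A \<in> \<nu> ` V"
proof -
  interpret canonical_optimal_factorization_tree V r\<^sub>0 \<phi> \<alpha> \<nu>
    by (rule assms(2))
  show ?thesis
    using assms(3,4) optimal_imp_locally_minimal[OF assms(4)]
    by (intro locally_minimal_in_labels)
       (auto simp: separation_index_def optimal_factorization_def)
qed

end
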